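(* Let $c<\sqrt{2}$. Then there exist real numbers $H,H_\infty\ge1$ with $H_\infty>c\,H$, a sequence $\{f_j\}_{j=1}^\infty$ of $H$-quasiconformal mappings $f_j:\mathbb{R}^3\to\mathbb{R}^3$, and a mapping $f:\mathbb{R}^3\to\mathbb{R}^3$ such that $f_j\to f$ uniformly on $\mathbb{R}^3$ and $f$ is $H_\infty$-quasiconformal but is not $H'$-quasiconformal for any $H'<H_\infty$.
   Context: For a homeomorphism $f:\mathbb{R}^3\to\mathbb{R}^3$ and $x\in\mathbb{R}^3$, the linear distortion of $f$ at $x$ is $$\mathcal{H}(x,f)=\limsup_{r\to0}\frac{\max_{|h|=r}|f(x+h)-f(x)|}{\min_{|h|=r}|f(x+h)-f(x)|},$$ and $\mathcal{H}(f)=\operatorname{ess\,sup}_{x\in\mathbb{R}^3}\mathcal{H}(x,f)$. For $H\ge1$, a homeomorphism $f$ is called $H$-quasiconformal if $\mathcal{H}(x,f)$ is bounded on $\mathbb{R}^3$ and $\mathcal{H}(f)\le H$. *)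

theory Defs
  imports "HOL-Analysis.Analysis" "HOL-Probability.Essential_Supremum"
begin

text \<open>
  For continuous \<open>f\<close> and \<open>r > 0\<close> the supremum and infimum over the compact sphere are attained,
  so they are the maximum and minimum; if \<open>f\<close> is also injective, the minimum is positive.
\<close>

definition linear_distortion :: "(real ^ 3 \<Rightarrow> real ^ 3) \<Rightarrow> real ^ 3 \<Rightarrow> ereal" where
  "linear_distortion f x =
     Limsup (at_right (0::real))
       (\<lambda>r. (SUP h\<in>sphere 0 r. ereal (norm (f (x + h) - f x))) /
            (INF h\<in>sphere 0 r. ereal (norm (f (x + h) - f x))))"

text \<open>
  The library's \<open>esssup\<close> is \<open>\<infinity>\<close> by convention on non-measurable functions. This does not occur
  for a homeomorphism \<open>f\<close>: the quotient is then jointly continuous in \<open>x\<close> and \<open>r > 0\<close>, so the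
  upper limit may be taken along rational \<open>r\<close> and is Borel measurable in \<open>x\<close>.
\<close>

definition max_distortion :: "(real ^ 3 \<Rightarrow> real ^ 3) \<Rightarrow> ereal" where
  "max_distortion f = esssup lebesgue (linear_distortion f)"

definition quasiconformal :: "real \<Rightarrow> (real ^ 3 \<Rightarrow> real ^ 3) \<Rightarrow> bool" where
  "quasiconformal H f \<longleftrightarrow>
     1 \<le> H \<and>
     (\<exists>g. homeomorphism UNIV UNIV f g) \<and>
     (\<exists>B::real. \<forall>x. linear_distortion f x \<le> ereal B) \<and>
     max_distortion f \<le> ereal H"

end

theory Submission
  imports Defs
begin

text \<open>
  In dimension three the linear distortion (the quotient of the extreme singular values) is not
  rank-one convex. There are matrices $M$, $a$, $n$ such that both $M + a n^T$ and $M - a n^T$ have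
  linear distortion at most $7000$, but their mean $M = \mathrm{diag}(100, 1/100, 1)$ has linear
  distortion $10000 > 7000 \sqrt 2$. The mappings $x \mapsto Mx + k^{-1} z(k\, n \cdot x)\, a$ with a
  zigzag function $z$ of slopes $\pm 1$ have these two gradients almost everywhere and converge
  uniformly to the linear map $M$. Hence a single example works for all $c < \sqrt 2$.
\<close>

section \<open>Linear distortion\<close>

lemma eventually_at_right_0I:
  assumes "0 < e"
    and "\<And>r. 0 < r \<Longrightarrow> r < e \<Longrightarrow> P r"
  shows "eventually P (at_right (0::real))"
  using assms by (auto simp: eventually_at_right_field)

text \<open>On the sphere of radius \<open>r < e\<close> the supremum is at most
  \<open>P * r\<close> and the infimum at least \<open>p * r > 0\<close>, so the factor
  \<open>r\<close> cancels in the quotient.\<close>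

lemma linear_distortion_le:
  assumes "0 < p" "0 < P" "0 < e"
    and lower: "\<And>h. norm h < e \<Longrightarrow> p * norm h \<le> norm (f (x + h) - f x)"
    and upper: "\<And>h. norm h < e \<Longrightarrow> norm (f (x + h) - f x) \<le> P * norm h"
  shows "linear_distortion f x \<le> ereal (P / p)"
  unfolding linear_distortion_def
proof (intro Limsup_bounded eventually_at_right_0I[OF \<open>0 < e\<close>])
  fix r :: real
  assume r: "0 < r" "r < e"
  let ?S = "SUP h\<in>sphere 0 r. ereal (norm (f (x + h) - f x))"
  let ?I = "INF h\<in>sphere 0 r. ereal (norm (f (x + h) - f x))"
  have S: "?S \<le> ereal (P * r)"
    using upper r by (intro SUP_least) auto
  have I: "ereal (p * r) \<le> ?I"
    using lower r by (intro INF_greatest) auto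
  have pr: "0 < ereal (p * r)" "0 < ereal (P * r)"
    using r assms by auto
  have I0: "0 < ?I"
    using pr(1) I by (rule less_le_trans)
  have "?S / ?I \<le> ereal (P * r) / ?I"
    using S I0 by (rule ereal_divide_right_mono)
  also have "\<dots> \<le> ereal (P * r) / ereal (p * r)"
    using I pr I0 by (intro ereal_divide_left_mono) (auto simp: ereal_zero_less_0_iff)
  also have "\<dots> = ereal (P / p)"
    using r assms by simp
  finally show "?S / ?I \<le> ereal (P / p)" .
qed

text \<open>By homogeneity, the directions \<open>v\<close> and \<open>w\<close> give the same ratio
  on every sphere, so each quotient under the upper limit is at least this ratio. It serves to bound
  the distortion of the limit map from below.\<close>

lemma linear_distortion_linear_ge:
  assumes f: "linear f" and "norm v = 1" "norm w = 1" "0 < norm (f w)"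
  shows "ereal (norm (f v) / norm (f w)) \<le> linear_distortion f x"
  unfolding linear_distortion_def
proof (intro le_Limsup eventually_at_right_0I[OF zero_less_one])
  fix r :: real
  assume r: "0 < r"
  let ?d = "\<lambda>h. ereal (norm (f (x + h) - f x))"
  let ?S = "SUP h\<in>sphere 0 r. ?d h"
  let ?I = "INF h\<in>sphere 0 r. ?d h"
  have d: "?d (r *\<^sub>R u) = ereal (r * norm (f u))" for u
    using r f by (simp add: linear_add linear_scale)
  have S: "ereal (r * norm (f v)) \<le> ?S"
    using r assms unfolding d[symmetric] by (intro SUP_upper) auto
  have I: "?I \<le> ereal (r * norm (f w))"
    using r assms unfolding d[symmetric] by (intro INF_lower) auto
  have I0: "0 \<le> ?I"
    by (intro INF_greatest) auto
  \<comment> \<open>Writing the quotient as a product with an inverse also covers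
    \<open>?I = 0\<close>, because the inverse of 0 in \<open>ereal\<close> is infinity and
    inversion is antitone on nonnegative values.\<close>
  have "ereal (norm (f v) / norm (f w)) = ereal (r * norm (f v)) * inverse (ereal (r * norm (f w)))"
    using r assms by (simp add: divide_simps)
  also have "\<dots> \<le> ?S * inverse ?I"
    using S ereal_inverse_antimono[OF I0 I] r assms I0
    by (intro ereal_mult_mono) (auto intro: order_trans[OF _ S])
  finally show "ereal (norm (f v) / norm (f w)) \<le> ?S / ?I"
    by (simp add: divide_ereal_def)
qed simp

text \<open>Only norms of small increments enter the distortion. The base points may differ, so a
  locally affine map can be compared with its linear part at the origin.\<close>

lemma linear_distortion_local_cong:
  assumes "0 < e"
    and "\<And>h. norm h < e \<Longrightarrow> norm (f (x + h) - f x) = norm (g (y + h) - g y)"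
  shows "linear_distortion f x = linear_distortion g y"
  unfolding linear_distortion_def
  by (intro Limsup_eq eventually_at_right_0I[OF \<open>0 < e\<close>] arg_cong2[where f="(/)"] SUP_cong INF_cong)
     (auto simp: assms)

section \<open>The zigzag function\<close>

definition zigzag :: "real \<Rightarrow> real" where
  "zigzag t = \<bar>t - of_int (round t)\<bar>"

lemma zigzag_bounded: "\<bar>zigzag t\<bar> \<le> 1 / 2"
  using of_int_round_abs_le[of t] by (simp add: zigzag_def abs_minus_commute)

text \<open>The integer nearest to \<open>s\<close> is at least as close to \<open>s\<close> as the
  integer nearest to \<open>t\<close>; the triangle inequality does the rest.\<close>

lemma zigzag_Lipschitz: "\<bar>zigzag s - zigzag t\<bar> \<le> \<bar>s - t\<bar>"
proof -
  have "zigzag s \<le> zigzag t + \<bar>s - t\<bar>" for s t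
    using round_diff_minimal[of s "round t"] by (simp add: zigzag_def)
  from this[of s t] this[of t s] show ?thesis
    by linarith
qed

lemma continuous_on_zigzag: "continuous_on S zigzag"
proof (rule lipschitz_on_continuous_on)
  show "1-lipschitz_on S zigzag"
    by (rule lipschitz_onI) (use zigzag_Lipschitz in \<open>auto simp: dist_real_def\<close>)
qed

lemma zigzag_eq:
  assumes "\<bar>t - of_int m\<bar> < 1 / 2"
  shows "zigzag t = \<bar>t - of_int m\<bar>"
  using round_unique'[OF assms] by (simp add: zigzag_def)

text \<open>The open intervals on which \<open>zigzag\<close> has slope 1; on \<open>falling\<close>
  the slope is -1. The kinks, at the half-integers \<open>m / 2\<close>, belong to neither
  set.\<close>

definition rising :: "real set" where
  "rising = (\<Union>m::int. {of_int m <..< of_int m + 1 / 2})"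

definition falling :: "real set" where
  "falling = (\<Union>m::int. {of_int m - 1 / 2 <..< of_int m})"

lemma open_rising: "open rising" and open_falling: "open falling"
  by (auto simp: rising_def falling_def)

lemma half_integer_if_not_rising_falling:
  assumes "t \<notin> rising" "t \<notin> falling"
  shows "\<exists>m::int. t = of_int m / 2"
proof (rule ccontr)
  assume neg: "\<nexists>m::int. t = of_int m / 2"
  let ?m = "round t"
  have "\<bar>t - of_int ?m\<bar> \<le> 1 / 2"
    using of_int_round_abs_le[of t] by (simp add: abs_minus_commute)
  \<comment> \<open>These are the only multiples of 1/2 within distance 1/2 of \<open>?m\<close>;
    without them two open intervals remain.\<close>
  moreover have "t \<noteq> of_int (2 * ?m) / 2" "t \<noteq> of_int (2 * ?m + 1) / 2" "t \<noteq> of_int (2 * ?m - 1) / 2"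
    using neg by blast+
  ultimately have "t \<in> {of_int ?m <..< of_int ?m + 1 / 2} \<or> t \<in> {of_int ?m - 1 / 2 <..< of_int ?m}"
    by (auto simp: abs_if field_simps split: if_splits)
  then show False
    using assms by (auto simp: rising_def falling_def)
qed

lemma zigzag_rising:
  assumes "t \<in> rising"
  shows "\<exists>e>0. \<forall>s. \<bar>s\<bar> < e \<longrightarrow> zigzag (t + s) - zigzag t = s"
proof -
  obtain m :: int where m: "t \<in> {of_int m <..< of_int m + 1 / 2}"
    using assms by (auto simp: rising_def)
  have "zigzag u = u - of_int m" if "u \<in> {of_int m <..< of_int m + 1 / 2}" for u
    using zigzag_eq[of u m] that by auto
  then have "zigzag (t + s) - zigzag t = s" if "\<bar>s\<bar> < min (t - of_int m) (of_int m + 1 / 2 - t)" for s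
    using that m by (auto simp: abs_less_iff)
  with m show ?thesis
    by (intro exI[of _ "min (t - of_int m) (of_int m + 1 / 2 - t)"]) auto
qed

lemma zigzag_falling:
  assumes "t \<in> falling"
  shows "\<exists>e>0. \<forall>s. \<bar>s\<bar> < e \<longrightarrow> zigzag (t + s) - zigzag t = - s"
proof -
  obtain m :: int where m: "t \<in> {of_int m - 1 / 2 <..< of_int m}"
    using assms by (auto simp: falling_def)
  have "zigzag u = of_int m - u" if "u \<in> {of_int m - 1 / 2 <..< of_int m}" for u
    using zigzag_eq[of u m] that by auto
  then have "zigzag (t + s) - zigzag t = - s" if "\<bar>s\<bar> < min (of_int m - t) (t - of_int m + 1 / 2)" for s
    using that m by (auto simp: abs_less_iff)
  with m show ?thesis
    by (intro exI[of _ "min (of_int m - t) (t - of_int m + 1 / 2)"]) auto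
qed

section \<open>Laminates\<close>

text \<open>The factor \<open>k\<close> inside and the division by \<open>k\<close> outside cancel
  in the derivative: for every \<open>k > 0\<close> the gradient off the creases is \<open>M\<close>
  plus or minus the rank-one map \<open>h \<mapsto> (n \<bullet> h) *\<^sub>R a\<close>, while the
  distance to \<open>M\<close> is of order \<open>1 / k\<close>.\<close>

definition laminate :: "('a::euclidean_space \<Rightarrow> 'a) \<Rightarrow> 'a \<Rightarrow> 'a \<Rightarrow> real \<Rightarrow> 'a \<Rightarrow> 'a" where
  "laminate M a n k x = M x + (zigzag (k * (n \<bullet> x)) / k) *\<^sub>R a"

text \<open>Every increment, even across creases, is that of a linear map on the segment between the
  two gradients, since difference quotients of \<open>zigzag\<close> lie in [-1, 1]. Global bounds
  thus reduce to bounds uniform in \<open>s\<close>.\<close>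

lemma laminate_increment:
  assumes "linear M" "0 < k"
  shows "\<exists>s. \<bar>s\<bar> \<le> 1 \<and> laminate M a n k (x + h) - laminate M a n k x = M h + (s * (n \<bullet> h)) *\<^sub>R a"
proof -
  let ?d = "zigzag (k * (n \<bullet> (x + h))) - zigzag (k * (n \<bullet> x))"
  have d: "\<bar>?d\<bar> \<le> \<bar>k * (n \<bullet> h)\<bar>"
    using zigzag_Lipschitz[of "k * (n \<bullet> (x + h))" "k * (n \<bullet> x)"]
    by (simp add: inner_right_distrib algebra_simps)
  \<comment> \<open>If \<open>n \<bullet> h = 0\<close>, division by zero yields
    \<open>s = 0\<close>, which is consistent because \<open>d\<close> then forces
    \<open>?d = 0\<close>.\<close>
  define s where "s = ?d / (k * (n \<bullet> h))"
  have "\<bar>s\<bar> \<le> 1"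
    using d by (auto simp: s_def divide_le_eq_1)
  moreover have "?d / k = s * (n \<bullet> h)"
    using d assms by (auto simp: s_def)
  moreover have "laminate M a n k (x + h) - laminate M a n k x = M h + (?d / k) *\<^sub>R a"
    using assms by (simp add: laminate_def linear_add diff_divide_distrib scaleR_left_diff_distrib)
  ultimately show ?thesis
    by auto
qed

lemma laminate_increment_locally:
  assumes "linear M" "0 < k"
    and z: "\<exists>e>0. \<forall>s. \<bar>s\<bar> < e \<longrightarrow> zigzag (k * (n \<bullet> x) + s) - zigzag (k * (n \<bullet> x)) = c * s"
  shows "\<exists>e>0. \<forall>h. norm h < e \<longrightarrow>
    laminate M a n k (x + h) - laminate M a n k x = M h + (c * (n \<bullet> h)) *\<^sub>R a"
proof -
  obtain e where e: "0 < e"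
    and eq: "\<And>s. \<bar>s\<bar> < e \<Longrightarrow> zigzag (k * (n \<bullet> x) + s) - zigzag (k * (n \<bullet> x)) = c * s"
    using z by blast
  \<comment> \<open>The summand 1 keeps the denominator positive even for
    \<open>n = 0\<close>.\<close>
  let ?e = "e / (k * (norm n + 1))"
  have k: "0 < k * (norm n + 1)"
    using assms by (intro mult_pos_pos) (auto intro: add_nonneg_pos)
  have "laminate M a n k (x + h) - laminate M a n k x = M h + (c * (n \<bullet> h)) *\<^sub>R a" if h: "norm h < ?e" for h
  proof -
    have "\<bar>k * (n \<bullet> h)\<bar> \<le> k * (norm n * norm h)"
      using assms Cauchy_Schwarz_ineq2[of n h] by (simp add: abs_mult)
    also have "\<dots> \<le> norm h * (k * (norm n + 1))"
      using assms by (simp add: algebra_simps)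
    also have "\<dots> < e"
      using h k by (simp add: pos_less_divide_eq)
    finally have "zigzag (k * (n \<bullet> (x + h))) - zigzag (k * (n \<bullet> x)) = c * (k * (n \<bullet> h))"
      using eq[of "k * (n \<bullet> h)"] by (simp add: inner_right_distrib distrib_left)
    then have "zigzag (k * (n \<bullet> (x + h))) / k - zigzag (k * (n \<bullet> x)) / k = c * (n \<bullet> h)"
      using assms by (simp add: field_simps)
    then show ?thesis
      using assms by (simp add: laminate_def linear_add flip: scaleR_left_diff_distrib)
  qed
  then show ?thesis
    using e k by (intro exI[of _ ?e]) auto
qed

section \<open>Bi-Lipschitz bounds and bijectivity of laminates\<close>

lemma laminate_le:
  fixes M :: "'a::euclidean_space \<Rightarrow> 'a"
  assumes M: "linear M" and k: "0 < k"
  obtains L where "0 < L"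
    and "\<And>x h. norm (laminate M a n k (x + h) - laminate M a n k x) \<le> L * norm h"
proof -
  obtain B where B: "0 < B" "\<And>x. norm (M x) \<le> B * norm x"
    using linear_bounded_pos[OF M] by blast
  have "norm (laminate M a n k (x + h) - laminate M a n k x) \<le> (B + norm n * norm a) * norm h" for x h
  proof -
    obtain s where s: "\<bar>s\<bar> \<le> 1"
      and eq: "laminate M a n k (x + h) - laminate M a n k x = M h + (s * (n \<bullet> h)) *\<^sub>R a"
      using laminate_increment[OF M k] by blast
    have "\<bar>s * (n \<bullet> h)\<bar> \<le> 1 * (norm n * norm h)"
      unfolding abs_mult using s Cauchy_Schwarz_ineq2[of n h] by (intro mult_mono) auto
    then have "\<bar>s * (n \<bullet> h)\<bar> * norm a \<le> norm n * norm h * norm a"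
      by (intro mult_right_mono) auto
    then have "norm (M h + (s * (n \<bullet> h)) *\<^sub>R a) \<le> B * norm h + norm n * norm h * norm a"
      using B(2)[of h] by (intro norm_triangle_le) auto
    then show ?thesis
      unfolding eq by (simp add: algebra_simps)
  qed
  moreover have "0 < B + norm n * norm a"
    using B by (simp add: add_pos_nonneg)
  ultimately show thesis
    using that by blast
qed

text \<open>A Sherman-Morrison argument. Applying \<open>N\<close> to an increment \<open>w\<close>
  and pairing with \<open>n\<close> gives \<open>n \<bullet> N w = (1 + s * (n \<bullet> N a)) * (n
  \<bullet> h)\<close>. The factor stays away from 0 by smallness, so \<open>w\<close> controls
  \<open>n \<bullet> h\<close> and then \<open>h\<close> itself.\<close>

lemma laminate_ge:
  fixes M :: "'a::euclidean_space \<Rightarrow> 'a"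
  assumes M: "linear M" and N: "linear N" "\<And>x. N (M x) = x"
    and small: "\<bar>n \<bullet> N a\<bar> < 1" and k: "0 < k"
  obtains l where "0 < l"
    and "\<And>x h. l * norm h \<le> norm (laminate M a n k (x + h) - laminate M a n k x)"
proof -
  let ?g = "1 - \<bar>n \<bullet> N a\<bar>"
  obtain B where B: "0 < B" "\<And>x. norm (N x) \<le> B * norm x"
    using linear_bounded_pos[OF N(1)] by blast
  define C where "C = B + norm n * B * norm (N a) / ?g"
  have C: "0 < C"
    using B small by (auto simp: C_def intro!: add_pos_nonneg)
  have "norm h \<le> C * norm (laminate M a n k (x + h) - laminate M a n k x)" for x h
  proof -
    obtain s where s: "\<bar>s\<bar> \<le> 1"
      and eq: "laminate M a n k (x + h) - laminate M a n k x = M h + (s * (n \<bullet> h)) *\<^sub>R a"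
      using laminate_increment[OF M k] by blast
    define w where "w = M h + (s * (n \<bullet> h)) *\<^sub>R a"
    have Nw: "N w = h + (s * (n \<bullet> h)) *\<^sub>R N a"
      using N by (simp add: w_def linear_add linear_scale)
    have "\<bar>s * (n \<bullet> N a)\<bar> \<le> 1 * \<bar>n \<bullet> N a\<bar>"
      unfolding abs_mult using s by (intro mult_right_mono) auto
    then have "?g * \<bar>n \<bullet> h\<bar> \<le> \<bar>1 + s * (n \<bullet> N a)\<bar> * \<bar>n \<bullet> h\<bar>"
      by (intro mult_right_mono) auto
    also have "\<dots> = \<bar>n \<bullet> N w\<bar>"
      unfolding abs_mult[symmetric] by (simp add: Nw inner_right_distrib algebra_simps)
    also have "\<dots> \<le> norm n * (B * norm w)"
      using Cauchy_Schwarz_ineq2[of n "N w"] B(2)[of w]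
      by (meson mult_left_mono norm_ge_zero order_trans)
    finally have nh: "\<bar>n \<bullet> h\<bar> \<le> norm n * (B * norm w) / ?g"
      using small by (simp add: pos_le_divide_eq mult.commute)
    have "\<bar>s * (n \<bullet> h)\<bar> \<le> 1 * (norm n * (B * norm w) / ?g)"
      unfolding abs_mult using s nh by (intro mult_mono) auto
    then have "\<bar>s * (n \<bullet> h)\<bar> * norm (N a) \<le> norm n * (B * norm w) / ?g * norm (N a)"
      by (intro mult_right_mono) auto
    moreover have "norm h \<le> norm (N w) + \<bar>s * (n \<bullet> h)\<bar> * norm (N a)"
      using norm_triangle_ineq4[of "N w" "(s * (n \<bullet> h)) *\<^sub>R N a"] by (simp add: Nw)
    ultimately have "norm h \<le> B * norm w + norm n * (B * norm w) / ?g * norm (N a)"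
      using B(2)[of w] by linarith
    also have "\<dots> = C * norm w"
      by (simp add: C_def algebra_simps)
    finally show ?thesis
      by (simp add: eq w_def)
  qed
  then have "1 / C * norm h \<le> norm (laminate M a n k (x + h) - laminate M a n k x)" for x h
    using C by (simp add: divide_simps mult.commute)
  then show thesis
    using that[of "1 / C"] C by simp
qed

text \<open>With \<open>t = n \<bullet> x\<close>, applying \<open>N\<close> to the equation for a
  preimage of \<open>y\<close> determines \<open>x\<close> from \<open>t\<close> and leaves the
  scalar equation \<open>\<phi> t = n \<bullet> N y\<close>. As \<open>\<phi>\<close> is continuous
  and differs from the identity by a bounded term, the intermediate value theorem solves it.\<close>

lemma surj_laminate:
  fixes M :: "'a::euclidean_space \<Rightarrow> 'a"
  assumes M: "linear M" and N: "linear N" "\<And>x. M (N x) = x" and k: "0 < k"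
  shows "surj (laminate M a n k)"
proof -
  have "\<exists>x. laminate M a n k x = y" for y
  proof -
    let ?g = "n \<bullet> N a"
    define \<phi> where "\<phi> t = t + ?g * (zigzag (k * t) / k)" for t
    define T where "T = \<bar>n \<bullet> N y\<bar> + \<bar>?g\<bar> / k"
    have bound: "\<bar>?g * (zigzag (k * t) / k)\<bar> \<le> \<bar>?g\<bar> / k" for t
      using zigzag_bounded[of "k * t"] k
      by (simp add: abs_mult divide_simps mult_left_le)
    have "T \<ge> 0"
      using k by (simp add: T_def)
    moreover have "\<phi> (- T) \<le> n \<bullet> N y" "n \<bullet> N y \<le> \<phi> T"
      using bound[of "- T"] bound[of T] unfolding \<phi>_def T_def by linarith+
    moreover have "continuous_on {- T..T} \<phi>"
      unfolding \<phi>_def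
      by (intro continuous_intros continuous_on_compose2[OF continuous_on_zigzag[of UNIV]]) (use k in auto)
    ultimately obtain t where t: "\<phi> t = n \<bullet> N y"
      using IVT'[of \<phi> "- T" "n \<bullet> N y" T] by auto
    let ?x = "N y - (zigzag (k * t) / k) *\<^sub>R N a"
    have "n \<bullet> ?x = t"
      using t by (simp add: \<phi>_def inner_diff_right algebra_simps)
    then have "laminate M a n k ?x = y"
      using M N by (simp add: laminate_def linear_diff linear_scale)
    then show ?thesis ..
  qed
  then show ?thesis
    by (metis surjI)
qed

text \<open>Injectivity comes from the lower bound \<open>laminate_ge\<close>, continuity of the
  inverse from invariance of domain.\<close>

lemma homeomorphism_laminate:
  fixes M :: "'a::euclidean_space \<Rightarrow> 'a"
  assumes M: "linear M" and N: "linear N" "\<And>x. N (M x) = x" "\<And>x. M (N x) = x"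
    and small: "\<bar>n \<bullet> N a\<bar> < 1" and k: "0 < k"
  shows "\<exists>g. homeomorphism UNIV UNIV (laminate M a n k) g"
proof -
  let ?f = "laminate M a n k"
  obtain l where l: "0 < l" "\<And>x h. l * norm h \<le> norm (?f (x + h) - ?f x)"
    using laminate_ge[OF M N(1,2) small k] by blast
  have "inj ?f"
  proof (rule injI)
    fix x y
    assume "?f x = ?f y"
    then show "x = y"
      using l(1) l(2)[of "y - x" x] by (simp add: mult_le_0_iff)
  qed
  moreover have "continuous_on UNIV ?f"
    unfolding laminate_def
    by (intro continuous_intros continuous_on_compose2[OF continuous_on_zigzag[of UNIV]]
        linear_continuous_on linear_conv_bounded_linear[THEN iffD1] M) (use k in auto)
  ultimately obtain g where "homeomorphism UNIV (?f ` UNIV) ?f g"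
    using invariance_of_domain_homeomorphism[of UNIV ?f] by auto
  then show ?thesis
    using surj_laminate[OF M N(1,3) k] by auto
qed

section \<open>Distortion and uniform convergence of laminates\<close>

lemma negligible_laminate_creases:
  fixes n :: "'a::euclidean_space"
  assumes "n \<noteq> 0" "0 < k"
  shows "negligible {x. k * (n \<bullet> x) \<notin> rising \<and> k * (n \<bullet> x) \<notin> falling}"
proof (rule negligible_subset)
  show "negligible (\<Union>m::int. {x. n \<bullet> x = of_int m / 2 / k})"
    using assms by (intro negligible_countable_Union) (auto intro!: negligible_hyperplane)
  show "{x. k * (n \<bullet> x) \<notin> rising \<and> k * (n \<bullet> x) \<notin> falling} \<subseteq> (\<Union>m::int. {x. n \<bullet> x = of_int m / 2 / k})"
    using half_integer_if_not_rising_falling assms(2) by (fastforce simp: field_simps)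
qed

text \<open>Off the null set of creases the map is locally affine, so its distortion takes only the
  two values belonging to the two gradients. On the creases a finite bound suffices, and the
  bi-Lipschitz estimates supply it.\<close>

lemma quasiconformal_laminate:
  fixes M N :: "real ^ 3 \<Rightarrow> real ^ 3"
  assumes M: "linear M" and N: "linear N" "\<And>x. N (M x) = x" "\<And>x. M (N x) = x"
    and small: "\<bar>n \<bullet> N a\<bar> < 1" and k: "0 < k" and n: "n \<noteq> 0"
    and H: "1 \<le> H"
    and p: "0 < p" "\<And>h. p * norm h \<le> norm (M h + (n \<bullet> h) *\<^sub>R a)"
      "\<And>h. norm (M h + (n \<bullet> h) *\<^sub>R a) \<le> H * p * norm h"
    and q: "0 < q" "\<And>h. q * norm h \<le> norm (M h - (n \<bullet> h) *\<^sub>R a)"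
      "\<And>h. norm (M h - (n \<bullet> h) *\<^sub>R a) \<le> H * q * norm h"
  shows "quasiconformal H (laminate M a n k)"
proof -
  let ?f = "laminate M a n k"
  let ?D = "linear_distortion ?f"
  let ?A = "\<lambda>h. M h + (n \<bullet> h) *\<^sub>R a" and ?B = "\<lambda>h. M h - (n \<bullet> h) *\<^sub>R a"
  define U where "U = {x. k * (n \<bullet> x) \<in> rising}"
  define V where "V = {x. k * (n \<bullet> x) \<in> falling}"
  define Z where "Z = {x. k * (n \<bullet> x) \<notin> rising \<and> k * (n \<bullet> x) \<notin> falling}"
  have cont: "continuous_on UNIV (\<lambda>x. k * (n \<bullet> x))"
    by (intro continuous_intros)
  have sets: "U \<in> sets lebesgue" "V \<in> sets lebesgue"
    using open_vimage[OF open_rising cont] open_vimage[OF open_falling cont]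
    by (auto simp: U_def V_def vimage_def intro: lebesgue_openin)
  have Z: "negligible Z"
    unfolding Z_def using n k by (rule negligible_laminate_creases)
  have 0: "M 0 = 0"
    using M by (rule linear_0)
  have DU: "?D x = linear_distortion ?A 0" if x: "x \<in> U" for x
  proof -
    obtain e where "0 < e" "\<And>h. norm h < e \<Longrightarrow> ?f (x + h) - ?f x = ?A h"
      using laminate_increment_locally[OF M k, of n x 1 a] zigzag_rising[of "k * (n \<bullet> x)"] x
      by (auto simp: U_def)
    then show ?thesis
      by (intro linear_distortion_local_cong) (auto simp: 0)
  qed
  have DV: "?D x = linear_distortion ?B 0" if x: "x \<in> V" for x
  proof -
    obtain e where "0 < e" "\<And>h. norm h < e \<Longrightarrow> ?f (x + h) - ?f x = ?B h"
      using laminate_increment_locally[OF M k, of n x "-1" a] zigzag_falling[of "k * (n \<bullet> x)"] x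
      by (auto simp: V_def)
    then show ?thesis
      by (intro linear_distortion_local_cong) (auto simp: 0)
  qed
  have le: "linear_distortion ?A 0 \<le> ereal H" "linear_distortion ?B 0 \<le> ereal H"
    using linear_distortion_le[of p "H * p" 1 ?A 0] linear_distortion_le[of q "H * q" 1 ?B 0] p q H
    by (auto simp: 0)
  \<comment> \<open>Measurability must be shown because \<open>esssup\<close> is infinite otherwise.
    The distortion is constant on \<open>U\<close> and on \<open>V\<close>, and all subsets of the
    null set \<open>Z\<close> are Lebesgue measurable, so the preimage of any set \<open>S\<close>
    is measurable.\<close>
  have meas: "?D \<in> borel_measurable lebesgue"
  proof (rule measurableI)
    fix S :: "ereal set"
    have null: "?D -` S \<inter> Z \<in> sets lebesgue"
      using Z by (intro negligible_imp_sets negligible_subset[OF Z]) auto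
    have eq: "?D -` S = (?D -` S \<inter> Z) \<union>
        (if linear_distortion ?A 0 \<in> S then U else {}) \<union> (if linear_distortion ?B 0 \<in> S then V else {})"
    proof -
      have "UNIV = Z \<union> U \<union> V"
        by (auto simp: U_def V_def Z_def)
      then show ?thesis
        using DU DV by auto
    qed
    have "?D -` S \<in> sets lebesgue"
      by (subst eq, intro sets.Un null) (use sets in auto)
    then show "?D -` S \<inter> space lebesgue \<in> sets lebesgue"
      by simp
  qed auto
  have "AE x in lebesgue. ?D x \<le> ereal H"
  proof (rule AE_I')
    show "Z \<in> null_sets lebesgue"
      using Z by (simp add: negligible_iff_null_sets)
    show "{x \<in> space lebesgue. \<not> ?D x \<le> ereal H} \<subseteq> Z"
      using DU DV le by (auto simp: Z_def U_def V_def)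
  qed
  with meas have "max_distortion ?f \<le> ereal H"
    unfolding max_distortion_def by (rule esssup_I)
  moreover have "\<exists>B::real. \<forall>x. ?D x \<le> ereal B"
  proof -
    obtain L where "0 < L" "\<And>x h. norm (?f (x + h) - ?f x) \<le> L * norm h"
      using laminate_le[OF M k] by blast
    moreover obtain l where "0 < l" "\<And>x h. l * norm h \<le> norm (?f (x + h) - ?f x)"
      using laminate_ge[OF M N(1,2) small k] by blast
    ultimately have "?D x \<le> ereal (L / l)" for x
      by (intro linear_distortion_le[OF _ _ zero_less_one])
    then show ?thesis
      by blast
  qed
  moreover have "\<exists>g. homeomorphism UNIV UNIV ?f g"
    using homeomorphism_laminate[OF M N small k] .
  ultimately show ?thesis
    using H by (simp add: quasiconformal_def)
qed

text \<open>The zigzag term is bounded independently of \<open>x\<close> by a multiple of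
  \<open>norm a / k\<close>. The shift to \<open>Suc j\<close> keeps the scale positive.\<close>

lemma uniform_limit_laminate:
  "uniform_limit UNIV (\<lambda>j. laminate M a n (real (Suc j))) M sequentially"
proof (rule uniform_limitI)
  fix e :: real
  assume "0 < e"
  have "(\<lambda>j. norm a / real (Suc j)) \<longlonglongrightarrow> 0"
    by (intro tendsto_divide_0[OF tendsto_const] filterlim_compose[OF filterlim_real_sequentially]
        filterlim_at_top_imp_at_infinity filterlim_Suc)
  then have "eventually (\<lambda>j. norm a / real (Suc j) < e) sequentially"
    using \<open>0 < e\<close> by (rule order_tendstoD)
  then show "\<forall>\<^sub>F j in sequentially. \<forall>x\<in>UNIV. dist (laminate M a n (real (Suc j)) x) (M x) < e"
  proof eventually_elim
    case (elim j)
    have "dist (laminate M a n (real (Suc j)) x) (M x) \<le> norm a / real (Suc j)" for x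
    proof -
      have "\<bar>zigzag (real (Suc j) * (n \<bullet> x))\<bar> * norm a / real (Suc j) \<le> 1 * norm a / real (Suc j)"
        using zigzag_bounded[of "real (Suc j) * (n \<bullet> x)"]
        by (intro divide_right_mono mult_right_mono) auto
      then show ?thesis
        by (simp add: laminate_def dist_norm)
    qed
    with elim show ?case
      using le_less_trans by blast
  qed
qed

section \<open>The numerical example\<close>

text \<open>Sylvester's criterion for the symmetric matrix with rows \<open>(a, d, e)\<close>,
  \<open>(d, b, f)\<close>, \<open>(e, f, c)\<close>: the hypotheses concern its leading principal
  minors, and completing squares, scaled by the first two minors, gives the claim.\<close>

lemma quadratic_form_nonneg:
  fixes a b c d e f x y z :: real
  assumes "0 < a" "0 < a * b - d\<^sup>2"
    and "0 \<le> a * (b * c - f\<^sup>2) - d * (d * c - e * f) + e * (d * f - b * e)"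
  shows "0 \<le> a * x\<^sup>2 + b * y\<^sup>2 + c * z\<^sup>2 + 2 * d * (x * y) + 2 * e * (x * z) + 2 * f * (y * z)"
    (is "0 \<le> ?Q")
proof -
  define m where "m = a * b - d\<^sup>2"
  define D where "D = a * (b * c - f\<^sup>2) - d * (d * c - e * f) + e * (d * f - b * e)"
  have "a * m * ?Q = m * (a * x + d * y + e * z)\<^sup>2 + (m * y + (a * f - d * e) * z)\<^sup>2 + a * D * z\<^sup>2"
    unfolding m_def D_def by (simp add: power2_eq_square algebra_simps)
  also have "\<dots> \<ge> 0"
    using assms by (auto simp: m_def D_def intro!: add_nonneg_nonneg mult_nonneg_nonneg)
  finally have "0 \<le> a * m * ?Q" .
  moreover have "0 < a * m"
    using assms by (simp add: m_def)
  ultimately show ?thesis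
    by (simp only: zero_le_mult_iff) linarith
qed

lemma norm_vec3_squared: "(norm (x :: real ^ 3))\<^sup>2 = (x $ 1)\<^sup>2 + (x $ 2)\<^sup>2 + (x $ 3)\<^sup>2"
  by (simp add: norm_vec_def L2_set_def sum_3)

definition M0 :: "real ^ 3 \<Rightarrow> real ^ 3" where
  "M0 x = vector [100 * x $ 1, x $ 2 / 100, x $ 3]"

definition N0 :: "real ^ 3 \<Rightarrow> real ^ 3" where
  "N0 x = vector [x $ 1 / 100, 100 * x $ 2, x $ 3]"

text \<open>
  Both vectors are rounded from a numerical minimisation of the larger one of the distortions of
  \<open>M0 \<plusminus> a0 n0\<^sup>T\<close> for the given \<open>M0\<close>.
\<close>

definition a0 :: "real ^ 3" where
  "a0 = vector [50, - 1 / 10, - 3]"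

definition n0 :: "real ^ 3" where
  "n0 = vector [1, - 3 / 200, 1 / 2]"

lemma linear_M0: "linear M0" and linear_N0: "linear N0"
  by (auto intro!: linearI simp: M0_def N0_def vec_eq_iff forall_3 algebra_simps add_divide_distrib)

lemma N0_M0: "N0 (M0 x) = x" and M0_N0: "M0 (N0 x) = x"
  by (auto simp: M0_def N0_def vec_eq_iff forall_3)

lemma inner_n0: "n0 \<bullet> x = x $ 1 - 3 / 200 * x $ 2 + x $ 3 / 2"
  by (simp add: n0_def inner_vec_def sum_3)

text \<open>Bounds for the extreme singular values of the two gradients. After squaring, each one
  says that an explicit quadratic form in the coordinates of \<open>h\<close> is
  nonnegative.\<close>

lemma norm_gradient_bounds:
  shows "24 / 1000 * norm h \<le> norm (M0 h + (n0 \<bullet> h) *\<^sub>R a0)"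
    and "norm (M0 h + (n0 \<bullet> h) *\<^sub>R a0) \<le> 7000 * (24 / 1000) * norm h"
    and "9 / 1000 * norm h \<le> norm (M0 h - (n0 \<bullet> h) *\<^sub>R a0)"
    and "norm (M0 h - (n0 \<bullet> h) *\<^sub>R a0) \<le> 7000 * (9 / 1000) * norm h"
proof -
  define x y z where xyz: "x = h $ 1" "y = h $ 2" "z = h $ 3"
  have h: "(norm h)\<^sup>2 = x\<^sup>2 + y\<^sup>2 + z\<^sup>2"
    by (simp add: norm_vec3_squared xyz)
  have "(norm (M0 h + (n0 \<bullet> h) *\<^sub>R a0))\<^sup>2 =
      (150 * x - 3 / 4 * y + 25 * z)\<^sup>2 + (- 1 / 10 * x + 23 / 2000 * y - 1 / 20 * z)\<^sup>2
      + (- 3 * x + 9 / 200 * y - 1 / 2 * z)\<^sup>2"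
    by (simp add: norm_vec3_squared inner_n0 M0_def a0_def algebra_simps flip: xyz)
  also have "\<dots> = 2250901 / 100 * x\<^sup>2 + 2258629 / 4000000 * y\<^sup>2 + 250101 / 400 * z\<^sup>2
      - 2252723 / 10000 * (x * y) + 750301 / 100 * (x * z) - 750923 / 20000 * (y * z)"
    by (simp add: power2_eq_square algebra_simps)
  finally have A: "(norm (M0 h + (n0 \<bullet> h) *\<^sub>R a0))\<^sup>2 = \<dots>" .
  \<comment> \<open>The form is the squared norm from \<open>A\<close> minus
    \<open>(24 / 1000 * norm h)\<^sup>2\<close>; the later lower bound is analogous.\<close>
  have "0 \<le> 1406813089 / 62500 * x\<^sup>2 + 90253 / 160000 * y\<^sup>2 + 156312981 / 250000 * z\<^sup>2
      + 2 * (- 2252723 / 20000) * (x * y) + 2 * (750301 / 200) * (x * z) + 2 * (- 750923 / 40000) * (y * z)"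
    by (rule quadratic_form_nonneg) (simp_all add: power2_eq_square)
  then have "(24 / 1000 * norm h)\<^sup>2 \<le> (norm (M0 h + (n0 \<bullet> h) *\<^sub>R a0))\<^sup>2"
    unfolding power_mult_distrib A h by (simp add: power2_eq_square)
  then show "24 / 1000 * norm h \<le> norm (M0 h + (n0 \<bullet> h) *\<^sub>R a0)"
    by (rule power2_le_imp_le) simp
  \<comment> \<open>Here the squared norm is subtracted from \<open>(168 * norm h)\<^sup>2\<close>,
    where 168 is \<open>7000 * (24 / 1000)\<close>. For the other gradient 63 takes the place of
    168.\<close>
  have "0 \<le> 571499 / 100 * x\<^sup>2 + 112893741371 / 4000000 * y\<^sup>2 + 11039499 / 400 * z\<^sup>2
      + 2 * (2252723 / 20000) * (x * y) + 2 * (- 750301 / 200) * (x * z) + 2 * (750923 / 40000) * (y * z)"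
    by (rule quadratic_form_nonneg) (simp_all add: power2_eq_square)
  then have "(norm (M0 h + (n0 \<bullet> h) *\<^sub>R a0))\<^sup>2 \<le> (7000 * (24 / 1000) * norm h)\<^sup>2"
    unfolding power_mult_distrib A h by (simp add: power2_eq_square)
  then show "norm (M0 h + (n0 \<bullet> h) *\<^sub>R a0) \<le> 7000 * (24 / 1000) * norm h"
    by (rule power2_le_imp_le) simp
  have "(norm (M0 h - (n0 \<bullet> h) *\<^sub>R a0))\<^sup>2 =
      (50 * x + 3 / 4 * y - 25 * z)\<^sup>2 + (1 / 10 * x + 17 / 2000 * y + 1 / 20 * z)\<^sup>2
      + (3 * x - 9 / 200 * y + 5 / 2 * z)\<^sup>2"
    by (simp add: norm_vec3_squared inner_n0 M0_def a0_def algebra_simps flip: xyz)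
  also have "\<dots> = 250901 / 100 * x\<^sup>2 + 2258389 / 4000000 * y\<^sup>2 + 252501 / 400 * z\<^sup>2
      + 747317 / 10000 * (x * y) - 248499 / 100 * (x * z) - 754483 / 20000 * (y * z)"
    by (simp add: power2_eq_square algebra_simps)
  finally have B: "(norm (M0 h - (n0 \<bullet> h) *\<^sub>R a0))\<^sup>2 = \<dots>" .
  have "0 \<le> 2509009919 / 1000000 * x\<^sup>2 + 451613 / 800000 * y\<^sup>2 + 631252419 / 1000000 * z\<^sup>2
      + 2 * (747317 / 20000) * (x * y) + 2 * (- 248499 / 200) * (x * z) + 2 * (- 754483 / 40000) * (y * z)"
    by (rule quadratic_form_nonneg) (simp_all add: power2_eq_square)
  then have "(9 / 1000 * norm h)\<^sup>2 \<le> (norm (M0 h - (n0 \<bullet> h) *\<^sub>R a0))\<^sup>2"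
    unfolding power_mult_distrib B h by (simp add: power2_eq_square)
  then show "9 / 1000 * norm h \<le> norm (M0 h - (n0 \<bullet> h) *\<^sub>R a0)"
    by (rule power2_le_imp_le) simp
  have "0 \<le> 145999 / 100 * x\<^sup>2 + 15873741611 / 4000000 * y\<^sup>2 + 1335099 / 400 * z\<^sup>2
      + 2 * (- 747317 / 20000) * (x * y) + 2 * (248499 / 200) * (x * z) + 2 * (754483 / 40000) * (y * z)"
    by (rule quadratic_form_nonneg) (simp_all add: power2_eq_square)
  then have "(norm (M0 h - (n0 \<bullet> h) *\<^sub>R a0))\<^sup>2 \<le> (7000 * (9 / 1000) * norm h)\<^sup>2"
    unfolding power_mult_distrib B h by (simp add: power2_eq_square)
  then show "norm (M0 h - (n0 \<bullet> h) *\<^sub>R a0) \<le> 7000 * (9 / 1000) * norm h"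
    by (rule power2_le_imp_le) simp
qed

theorem theorem4:
  fixes c :: real
  assumes "c < sqrt 2"
  shows "\<exists>(H::real) (Hinf::real) (fs :: nat \<Rightarrow> real ^ 3 \<Rightarrow> real ^ 3) (f :: real ^ 3 \<Rightarrow> real ^ 3).
           1 \<le> H \<and> 1 \<le> Hinf \<and> Hinf > c * H \<and>
           (\<forall>j. quasiconformal H (fs j)) \<and>
           uniform_limit UNIV fs f sequentially \<and>
           quasiconformal Hinf f \<and>
           (\<forall>H'<Hinf. \<not> quasiconformal H' f)"
proof -
  \<comment> \<open>Since 100/49 exceeds 2, the ratio 10000/7000 of the two distortions beats every
    \<open>c < sqrt 2\<close>.\<close>
  have "sqrt 2 \<le> 10 / (7 :: real)"
    by (rule real_le_lsqrt) (auto simp: power2_eq_square)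
  with assms have c: "c * 7000 < 10000"
    by simp
  have fs: "quasiconformal 7000 (laminate M0 a0 n0 (real (Suc j)))" for j
  proof (rule quasiconformal_laminate[OF linear_M0 linear_N0 N0_M0 M0_N0])
    \<comment> \<open>The inner product equals -17/20.\<close>
    show "\<bar>n0 \<bullet> N0 a0\<bar> < 1"
      by (simp add: inner_n0 N0_def a0_def)
    have "n0 $ 1 \<noteq> 0 $ 1"
      by (simp add: n0_def)
    then show "n0 \<noteq> 0"
      by metis
    show "0 < 24 / (1000 :: real)" "0 < 9 / (1000 :: real)" "1 \<le> (7000 :: real)" "0 < real (Suc j)"
      by auto
  qed (rule norm_gradient_bounds)+
  have M0: "linear_distortion M0 x = ereal 10000" for x
  proof (rule antisym)
    have sq: "(norm (M0 h))\<^sup>2 = 10000 * (h $ 1)\<^sup>2 + (h $ 2)\<^sup>2 / 10000 + (h $ 3)\<^sup>2" for h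
      by (simp add: norm_vec3_squared M0_def power_divide power_mult_distrib)
    have "(1 / 100 * norm h)\<^sup>2 \<le> (norm (M0 h))\<^sup>2" "(norm (M0 h))\<^sup>2 \<le> (100 * norm h)\<^sup>2" for h
      unfolding power_mult_distrib sq norm_vec3_squared[of h] by (simp_all add: power_divide)
    then have "1 / 100 * norm h \<le> norm (M0 h)" "norm (M0 h) \<le> 100 * norm h" for h
      by (auto intro: power2_le_imp_le)
    then have "linear_distortion M0 x \<le> ereal (100 / (1 / 100))"
      using linear_M0 by (intro linear_distortion_le[of _ _ 1]) (auto simp: linear_add)
    then show "linear_distortion M0 x \<le> ereal 10000"
      by simp
    \<comment> \<open>The first two coordinate directions realise the extreme singular values 100
      and 1/100.\<close>
    have "(norm (M0 (axis 1 1)))\<^sup>2 = 100\<^sup>2" "(norm (M0 (axis 2 1)))\<^sup>2 = (1 / 100)\<^sup>2"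
      unfolding sq by (simp_all add: axis_def power_divide)
    then have e: "norm (M0 (axis 1 1)) = 100" "norm (M0 (axis 2 1)) = 1 / 100"
      by (simp_all only: power2_eq_iff_nonneg norm_ge_zero)
    show "ereal 10000 \<le> linear_distortion M0 x"
      using linear_distortion_linear_ge[OF linear_M0, of "axis 1 1" "axis 2 1" x, OF norm_axis_1 norm_axis_1]
      unfolding e by simp
  qed
  \<comment> \<open>Since the distortion is the same at every point, the essential supremum is
    exactly 10000; this yields both quasiconformality and the failure for every smaller
    constant.\<close>
  then have "linear_distortion M0 = (\<lambda>x. ereal 10000)"
    by auto
  then have max: "max_distortion M0 = ereal 10000"
    unfolding max_distortion_def by (simp add: esssup_const)
  have "\<exists>g. homeomorphism UNIV UNIV M0 g"
    using linear_M0 linear_N0 linear_continuous_on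
    by (intro exI[of _ N0] homeomorphismI) (auto simp: N0_M0 M0_N0 linear_conv_bounded_linear)
  with M0 max have "quasiconformal 10000 M0" "\<forall>H'<10000. \<not> quasiconformal H' M0"
    by (auto simp: quasiconformal_def)
  with c fs uniform_limit_laminate[of M0 a0 n0] show ?thesis
    by (intro exI[of _ 7000] exI[of _ 10000] exI[of _ "\<lambda>j. laminate M0 a0 n0 (real (Suc j))"] exI[of _ M0]) auto
qed

end
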